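(* Consider the stopping problem described in the context. Given any information structure $S$ and a prior belief $\mu_0\in\Delta\Theta$ (with $C(\mu_0)\neq\varnothing$), we have $$\rho^*(\mu_0)=V^N_0(\mu_0;\varnothing;\mathbf{0})-\pi(\mu_0).$$ Thus, the value $\rho^*(\mu_0)$ of the information structure can be achieved via the fee scheme that only charges an upfront fee equal to $V^N_0(\mu_0;\varnothing;\mathbf{0})-\pi(\mu_0)$.
   Context: Setting. A decision maker (DM) faces a stopping problem with decision horizon $N\in\mathbb{N}\cup\{+\infty\}$, periods $n=0,1,\dots,N$, and a time-invariant, initially unknown state of nature $\theta\in\Theta=\{\theta_1,\dots,\theta_m\}$, $m\ge 2$. $\Delta\Theta$ is the set of probability distributions on $\Theta$ and $\mu_0\in\Delta\Theta$ is the prior. In each period the DM either stops irrevocably and takes an action, or waits and acquires information. $A$ is a compact action set, and the stopping payoff $u(a,\theta)$ is bounded and continuous in $a$ for every $\theta$; $\pi(\mu):=\max_{a\in A}\sum_{\theta\in\Theta}u(a,\theta)\mu_\theta$ is the maximal expected stopping payoff at belief $\mu$. If the DM waits beyond the termination period she receives the payoff of an outside option, normalized to $0$ (so in the last period of a finite-horizon problem the value is $\max\{\pi(\mu),0\}$). The DM and the information provider who sets the fees share the discount factor $\delta\in(0,1]$. Information. An information structure $S$ is given by the signal distributions $f_\theta(s)$, $\theta\in\Theta$. If the DM acquires information in period $n$, she receives in period $n+1$ a signal $s$ generated by $S$; signals are independent conditional on the state. $\mu(s)$ is the Bayesian posterior of belief $\mu$ after signal $s$. $H_n$ is the collection of signal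 histories $h_n$ of length $n$, $\varnothing$ is the null history (the only history of length $0$), and $\mathcal{H}_N$ is the set of all histories, including $\varnothing$. $\mathbb{P}(h_n\mid\mu_0)$ is the probability of observing $h_n$ given the prior $\mu_0$, $\mu_0(h_n)$ is the posterior after $h_n$, and $h_{n,m}$, $0\le m<n$, is the predecessor of $h_n$ of length $m$. Expectations $\mathbb{E}(\cdot\mid\mu;h_n)$ are with respect to the signal $s$ to be obtained in period $n+1$, with $h_{n+1}$ being $h_n$ followed by $s$. Fee schemes and value functions. A fee scheme is a function $c:\mathcal{H}_N\to\mathbb{R}_+$; $c(h_n)$ is the (non-cumulative) amount to be paid in period $n$ given history $h_n$. $\mathbf{0}$ is the scheme charging zero after every history; a scheme that only charges an upfront fee has $c(h_n)=0$ for all $h_n\ne\varnothing$. The fee scheme is chosen and committed to in period $0$; a DM who declines it gets $\pi(\mu_0)$, and a DM who accepts it pays $c(\varnothing)$ and waits at least one period. The value functions satisfy $$V^N_0(\mu_0;\varnothing;c)=\max\{\pi(\mu_0),\ \delta[\mathbb{E}(V^N_1(\mu_0(s);h_1;c)\mid\mu_0;\varnothing)-\mathbb{E}(c(h_1)\mid\mu_0;\varnothing)]-c(\varnothing)\},$$ and, for $n\ge 1$, $$V^N_n(\mu;h_n;c)=\max\{\pi(\mu),\ \delta[\mathbb{E}(V^N_{n+1}(\mu(s);h_{n+1};c)\mid\mu;h_n)-\mathbb{E}(c(h_{n+1})\mid\mu;h_n)]\}.$$ The stopping sets are $E^N_n(h_n;c)=\{\mu\in\Delta\Theta: V^N_n(\mu;h_n;c)=\pi(\mu)\}$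 and the information acquisition sets are $A^N_n(h_n;c)=\Delta\Theta\setminus E^N_n(h_n;c)$. Value of information. $C(\mu_0):=\{c:\mathcal{H}_N\to\mathbb{R}_+\mid V^N_0(\mu_0;\varnothing;c)>\pi(\mu_0)\}$ is the set of fee schemes that the DM with prior $\mu_0$ strictly prefers to accept. For $c\in C(\mu_0)$, $\rho(\mu_0;c)$ is the discounted expected total fee that the DM, following her optimal strategy under $c$, expects ex ante to incur up to time $N$ (a fee is generated only when the DM chooses to acquire information; $c(h_n)$ is paid at period $n$ when the DM chooses to acquire information at period $n-1$ after observing the predecessor $h_{n,n-1}$), written as $$\rho(\mu_0;c):=\sum_{n=0}^{N}\sum_{h_n\in H_n}\delta^n c(h_n)\,\mathbb{P}(h_n\mid\mu_0)\,\mathbf{1}_{\{\mu_0(h_{n,m})\notin E^N_m(h_{n,m};c),\ \mu_0(h_n)\in A^N_n(h_n;c)\}},$$ where $m$ ranges over $0\le m<n$. The value of the information structure $S$ to the DM is $\rho^*(\mu_0):=\sup_{c\in C(\mu_0)}\rho(\mu_0;c)$. *)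

theory Defs
  imports "HOL-Probability.Probability"
begin

text \<open>
  The finite type \<open>'t\<close> is the state space, so beliefs are elements of \<open>'t pmf\<close>. Signals live in an
  arbitrary type \<open>'s\<close>, with signal distributions of countable support. A history is the list of
  signals received so far, oldest first; its length is the current period.
\<close>

record ('a, 't, 's) stopping_problem =
  actions :: "'a set"
  action_payoff :: "'a \<Rightarrow> 't \<Rightarrow> real"
  discount :: real
  horizon :: enat
  signal_dist :: "'t \<Rightarrow> 's pmf"

(* On a compact action set with continuous payoffs the supremum is a maximum. *)
definition stop_payoff :: "('a, 't::finite, 's) stopping_problem \<Rightarrow> 't pmf \<Rightarrow> real" where
  "stop_payoff P \<mu> = (SUP a\<in>actions P. \<Sum>\<theta>\<in>UNIV. action_payoff P a \<theta> * pmf \<mu> \<theta>)"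


subsection \<open>Signals, histories and beliefs\<close>

definition next_signal :: "('a, 't::finite, 's) stopping_problem \<Rightarrow> 't pmf \<Rightarrow> 's pmf" where
  "next_signal P \<mu> = bind_pmf \<mu> (signal_dist P)"

(* Bayes' rule; unspecified for signals of predictive probability 0, which never carry weight. *)
definition posterior ::
    "('a, 't::finite, 's) stopping_problem \<Rightarrow> 't pmf \<Rightarrow> 's \<Rightarrow> 't pmf" where
  "posterior P \<mu> s =
     embed_pmf (\<lambda>\<theta>. pmf \<mu> \<theta> * pmf (signal_dist P \<theta>) s / pmf (next_signal P \<mu>) s)"

definition belief_after ::
    "('a, 't::finite, 's) stopping_problem \<Rightarrow> 't pmf \<Rightarrow> 's list \<Rightarrow> 't pmf" where
  "belief_after P \<mu> h = foldl (posterior P) \<mu> h"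

definition history_dist ::
    "('a, 't::finite, 's) stopping_problem \<Rightarrow> 't pmf \<Rightarrow> nat \<Rightarrow> 's list pmf" where
  "history_dist P \<mu> n = bind_pmf \<mu> (\<lambda>\<theta>. replicate_pmf n (signal_dist P \<theta>))"

definition histories :: "('a, 't::finite, 's) stopping_problem \<Rightarrow> 's list set" where
  "histories P = {h. enat (length h) \<le> horizon P}"

text \<open>Values of a fee scheme outside \<^const>\<open>histories\<close> are irrelevant to everything below.\<close>

definition fee_schemes :: "('a, 't::finite, 's) stopping_problem \<Rightarrow> ('s list \<Rightarrow> real) set" where
  "fee_schemes P = histories P \<rightarrow> {0..}"

definition upfront_fee :: "real \<Rightarrow> 's list \<Rightarrow> real" where
  "upfront_fee x h = (if h = [] then x else 0)"


subsection \<open>Value functions\<close>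

text \<open>
  The right-hand side of the Bellman equation for waiting at history \<open>h\<close> with belief \<open>\<mu>\<close>, when
  \<open>v\<close> is the value function of the next period. The expected fee may be infinite, in which case
  waiting is worth \<open>- \<infinity>\<close>.
\<close>

definition continuation ::
    "('a, 't::finite, 's) stopping_problem \<Rightarrow> ('s list \<Rightarrow> real) \<Rightarrow> ('t pmf \<Rightarrow> 's list \<Rightarrow> real)
       \<Rightarrow> 't pmf \<Rightarrow> 's list \<Rightarrow> ereal" where
  "continuation P c v \<mu> h =
     ereal (discount P) *
       (ereal (measure_pmf.expectation (next_signal P \<mu>) (\<lambda>s. v (posterior P \<mu> s) (h @ [s])))
        - enn2ereal (\<integral>\<^sup>+ s. ennreal (c (h @ [s])) \<partial>measure_pmf (next_signal P \<mu>)))"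

(* Backward induction; the numeral argument is the number of periods left until the horizon. *)
primrec finite_value ::
    "('a, 't::finite, 's) stopping_problem \<Rightarrow> ('s list \<Rightarrow> real) \<Rightarrow> nat
       \<Rightarrow> 't pmf \<Rightarrow> 's list \<Rightarrow> real" where
  "finite_value P c 0 = (\<lambda>\<mu> h. max (stop_payoff P \<mu>) 0)"
| "finite_value P c (Suc k) = (\<lambda>\<mu> h.
     real_of_ereal (max (ereal (stop_payoff P \<mu>)) (continuation P c (finite_value P c k) \<mu> h)))"

text \<open>
  With an infinite horizon the Bellman equation alone does not determine the value function (for
  \<open>\<delta> = 1\<close> and zero fees every large constant solves it), so there the value is the supremum of
  the expected payoffs of all stopping rules. A stopping rule \<open>\<sigma>\<close> is the predicate of histories
  at which to stop. From history \<open>h\<close> on, the continuation \<open>l\<close> occurs if \<open>\<sigma>\<close> waits at \<open>h\<close> and at all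
  histories strictly between \<open>h\<close> and \<open>h @ l\<close>; then the fee \<open>c (h @ l)\<close> is due, whether or not \<open>\<sigma>\<close>
  stops at \<open>h @ l\<close>. Never stopping yields the outside option \<open>0\<close>, less the fees.
\<close>

definition waits_until :: "('s list \<Rightarrow> bool) \<Rightarrow> 's list \<Rightarrow> 's list \<Rightarrow> bool" where
  "waits_until \<sigma> h l \<longleftrightarrow> (\<forall>j<length l. \<not> \<sigma> (h @ take j l))"

definition rule_gain ::
    "('a, 't::finite, 's) stopping_problem \<Rightarrow> ('s list \<Rightarrow> bool) \<Rightarrow> 't pmf \<Rightarrow> 's list \<Rightarrow> real" where
  "rule_gain P \<sigma> \<mu> h =
     (\<Sum>k. discount P ^ k * measure_pmf.expectation (history_dist P \<mu> k)
        (\<lambda>l. stop_payoff P (belief_after P \<mu> l) * of_bool (waits_until \<sigma> h l \<and> \<sigma> (h @ l))))"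

definition rule_fees ::
    "('a, 't::finite, 's) stopping_problem \<Rightarrow> ('s list \<Rightarrow> real) \<Rightarrow> ('s list \<Rightarrow> bool)
       \<Rightarrow> 't pmf \<Rightarrow> 's list \<Rightarrow> ennreal" where
  "rule_fees P c \<sigma> \<mu> h =
     (\<Sum>k. ennreal (discount P ^ Suc k) * (\<integral>\<^sup>+ l. ennreal (c (h @ l)) * of_bool (waits_until \<sigma> h l)
        \<partial>measure_pmf (history_dist P \<mu> (Suc k))))"

definition infinite_value ::
    "('a, 't::finite, 's) stopping_problem \<Rightarrow> ('s list \<Rightarrow> real) \<Rightarrow> 't pmf \<Rightarrow> 's list \<Rightarrow> real" where
  "infinite_value P c \<mu> h =
     real_of_ereal (SUP \<sigma>. ereal (rule_gain P \<sigma> \<mu> h) - enn2ereal (rule_fees P c \<sigma> \<mu> h))"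

definition later_value ::
    "('a, 't::finite, 's) stopping_problem \<Rightarrow> ('s list \<Rightarrow> real) \<Rightarrow> 't pmf \<Rightarrow> 's list \<Rightarrow> real" where
  "later_value P c \<mu> h =
     (case horizon P of
        enat N \<Rightarrow> finite_value P c (N - length h) \<mu> h
      | \<infinity> \<Rightarrow> infinite_value P c \<mu> h)"

(* If period 0 is already the last one, waiting leads straight to the outside option. *)
definition accept_value ::
    "('a, 't::finite, 's) stopping_problem \<Rightarrow> ('s list \<Rightarrow> real) \<Rightarrow> 't pmf \<Rightarrow> ereal" where
  "accept_value P c \<mu> =
     (if horizon P = 0 then 0 else continuation P c (later_value P c) \<mu> []) - ereal (c [])"

definition value_fun ::
    "('a, 't::finite, 's) stopping_problem \<Rightarrow> ('s list \<Rightarrow> real) \<Rightarrow> 't pmf \<Rightarrow> 's list \<Rightarrow> real" where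
  "value_fun P c \<mu> h =
     (if h = [] then real_of_ereal (max (ereal (stop_payoff P \<mu>)) (accept_value P c \<mu>))
      else later_value P c \<mu> h)"

definition stop_set ::
    "('a, 't::finite, 's) stopping_problem \<Rightarrow> ('s list \<Rightarrow> real) \<Rightarrow> 's list \<Rightarrow> 't pmf set" where
  "stop_set P c h = {\<mu>. value_fun P c \<mu> h = stop_payoff P \<mu>}"

definition acquisition_set ::
    "('a, 't::finite, 's) stopping_problem \<Rightarrow> ('s list \<Rightarrow> real) \<Rightarrow> 's list \<Rightarrow> 't pmf set" where
  "acquisition_set P c h = UNIV - stop_set P c h"


subsection \<open>Expected fees and the value of information\<close>

definition acceptable_schemes ::
    "('a, 't::finite, 's) stopping_problem \<Rightarrow> 't pmf \<Rightarrow> ('s list \<Rightarrow> real) set" where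
  "acceptable_schemes P \<mu>0 = {c \<in> fee_schemes P. value_fun P c \<mu>0 [] > stop_payoff P \<mu>0}"

definition fees_where ::
    "('a, 't::finite, 's) stopping_problem \<Rightarrow> 't pmf \<Rightarrow> ('s list \<Rightarrow> real) \<Rightarrow> ('s list \<Rightarrow> bool)
       \<Rightarrow> ereal" where
  "fees_where P \<mu>0 c W =
     enn2ereal (\<Sum>n. if enat n \<le> horizon P
       then \<integral>\<^sup>+ h. ennreal (discount P ^ n * c h * pmf (history_dist P \<mu>0 n) h) * of_bool (W h)
              \<partial>count_space {h. length h = n}
       else 0)"

definition expected_fees ::
    "('a, 't::finite, 's) stopping_problem \<Rightarrow> 't pmf \<Rightarrow> ('s list \<Rightarrow> real) \<Rightarrow> ereal" where
  "expected_fees P \<mu>0 c = fees_where P \<mu>0 c (\<lambda>h.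
     (\<forall>m<length h. belief_after P \<mu>0 (take m h) \<notin> stop_set P c (take m h)) \<and>
     belief_after P \<mu>0 h \<in> acquisition_set P c h)"

text \<open>
  Same accounting for a decision maker who has accepted the scheme in period \<open>0\<close>: the condition at
  the null history is dropped. Differs from \<^const>\<open>expected_fees\<close> only when declining is optimal,
  in particular when she is indifferent.
\<close>

definition expected_fees_accepted ::
    "('a, 't::finite, 's) stopping_problem \<Rightarrow> 't pmf \<Rightarrow> ('s list \<Rightarrow> real) \<Rightarrow> ereal" where
  "expected_fees_accepted P \<mu>0 c = fees_where P \<mu>0 c (\<lambda>h.
     (\<forall>m<length h. 0 < m \<longrightarrow> belief_after P \<mu>0 (take m h) \<notin> stop_set P c (take m h)) \<and>
     (h \<noteq> [] \<longrightarrow> belief_after P \<mu>0 h \<in> acquisition_set P c h))"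

definition information_value ::
    "('a, 't::finite, 's) stopping_problem \<Rightarrow> 't pmf \<Rightarrow> ereal" where
  "information_value P \<mu>0 = (SUP c\<in>acceptable_schemes P \<mu>0. expected_fees P \<mu>0 c)"

end

theory Submission
  imports Defs
begin

text \<open>
  An upfront fee does not distort later decisions, so it can extract anything below the gain
  \<open>V(0) - \<pi>\<close> from waiting for free. Conversely, where waiting is strictly preferred, the Bellman
  equation of the fee scheme \<open>c\<close> holds with equality for its value \<open>V(c)\<close>, while \<open>V(0)\<close> is at least the
  discounted expectation of its next value. Hence, by induction on the number of periods, the expected
  fees over these periods are at most \<open>V(0) - V(c)\<close>. This uses only Bellman inequalities and
  never that waiting while \<open>V(c) \<noteq> \<pi>\<close> is optimal, which can fail for the infinite horizon and \<open>\<delta> = 1\<close>.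
\<close>

section \<open>Bayes' rule and the law of histories\<close>

lemma pmf_next_signal:
  "pmf (next_signal P \<mu>) s = (\<Sum>\<theta>\<in>UNIV. pmf \<mu> \<theta> * pmf (signal_dist P \<theta>) s)"
  unfolding next_signal_def pmf_bind
  by (subst integral_measure_pmf_real[of UNIV]) (auto simp: mult.commute)

text \<open>\<open>embed_pmf\<close> has the intended masses only for weights that sum to one;
  dividing by a positive predictive probability normalises them, whence the support
  assumption.\<close>

lemma pmf_posterior:
  assumes "s \<in> set_pmf (next_signal P \<mu>)"
  shows "pmf (posterior P \<mu> s) \<theta>
    = pmf \<mu> \<theta> * pmf (signal_dist P \<theta>) s / pmf (next_signal P \<mu>) s"
  unfolding posterior_def
proof (rule pmf_embed_pmf)
  have "pmf (next_signal P \<mu>) s > 0"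
    using assms by (simp add: pmf_positive)
  then have "(\<Sum>\<theta>\<in>UNIV. pmf \<mu> \<theta> * pmf (signal_dist P \<theta>) s / pmf (next_signal P \<mu>) s) = 1"
    by (simp add: sum_divide_distrib[symmetric] pmf_next_signal)
  then show "(\<integral>\<^sup>+ \<theta>. ennreal (pmf \<mu> \<theta> * pmf (signal_dist P \<theta>) s / pmf (next_signal P \<mu>) s)
      \<partial>count_space UNIV) = 1"
    by (simp add: nn_integral_count_space_finite sum_ennreal)
qed simp

text \<open>Both sides sample from the joint law of state and signal, factored signal first on the
  left and state first on the right. Conditioning on the first signal rests on this form of Bayes'
  rule.\<close>

lemma bind_posterior:
  "bind_pmf (next_signal P \<mu>) (\<lambda>s. bind_pmf (posterior P \<mu> s) (\<lambda>\<theta>. f \<theta> s))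
    = bind_pmf \<mu> (\<lambda>\<theta>. bind_pmf (signal_dist P \<theta>) (f \<theta>))"
proof -
  have joint: "bind_pmf (next_signal P \<mu>) (\<lambda>s. map_pmf (\<lambda>\<theta>. (\<theta>, s)) (posterior P \<mu> s))
    = bind_pmf \<mu> (\<lambda>\<theta>. map_pmf (Pair \<theta>) (signal_dist P \<theta>))" (is "?L = ?R")
  proof (rule pmf_eqI, clarify)
    fix \<theta> s
    have L: "pmf (map_pmf (\<lambda>\<theta>. (\<theta>, t)) (posterior P \<mu> t)) (\<theta>, s)
        = pmf (posterior P \<mu> s) \<theta> * indicator {s} t" for t
    proof (cases "t = s")
      case True
      then show ?thesis
        unfolding True by (subst pmf_map_inj') (auto simp: inj_on_def)
    next
      case False
      then show ?thesis
        by (subst pmf_map_outside) auto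
    qed
    have R: "pmf (map_pmf (Pair \<eta>) (signal_dist P \<eta>)) (\<theta>, s)
        = pmf (signal_dist P \<theta>) s * indicator {\<theta>} \<eta>" for \<eta>
    proof (cases "\<eta> = \<theta>")
      case True
      then show ?thesis
        unfolding True by (subst pmf_map_inj') (auto simp: inj_on_def)
    next
      case False
      then show ?thesis
        by (subst pmf_map_outside) auto
    qed
    have "pmf ?L (\<theta>, s) = pmf (posterior P \<mu> s) \<theta> * pmf (next_signal P \<mu>) s"
      unfolding pmf_bind L by (simp add: measure_pmf_single)
    also have "\<dots> = pmf (signal_dist P \<theta>) s * pmf \<mu> \<theta>"
    proof (cases "s \<in> set_pmf (next_signal P \<mu>)")
      case True
      then show ?thesis
        using pmf_positive[OF True] by (simp add: pmf_posterior)
    next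
      \<comment> \<open>At a signal of predictive probability zero the posterior is unspecified, but
        then every state has joint mass zero with that signal, so both sides vanish.\<close>
      case False
      then have "(\<Sum>\<theta>\<in>UNIV. pmf \<mu> \<theta> * pmf (signal_dist P \<theta>) s) = 0"
        by (simp add: pmf_next_signal[symmetric] set_pmf_iff)
      then have "pmf \<mu> \<theta> * pmf (signal_dist P \<theta>) s = 0"
        by (subst (asm) sum_nonneg_eq_0_iff) auto
      with False show ?thesis
        by (auto simp: set_pmf_iff)
    qed
    also have "\<dots> = pmf ?R (\<theta>, s)"
      unfolding pmf_bind R by (simp add: measure_pmf_single)
    finally show "pmf ?L (\<theta>, s) = pmf ?R (\<theta>, s)" .
  qed
  from arg_cong[OF joint, of "\<lambda>M. bind_pmf M (\<lambda>(\<theta>, s). f \<theta> s)"] show ?thesis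
    by (simp add: bind_assoc_pmf bind_map_pmf)
qed

lemma history_dist_0 [simp]: "history_dist P \<mu> 0 = return_pmf []"
  by (simp add: history_dist_def)

text \<open>Signals are independent only given the state, so the remaining signals have to be drawn
  under the posterior; \<open>bind_posterior\<close> swaps the order of drawing.\<close>

lemma history_dist_Suc:
  "history_dist P \<mu> (Suc n)
    = bind_pmf (next_signal P \<mu>) (\<lambda>s. map_pmf (Cons s) (history_dist P (posterior P \<mu> s) n))"
proof -
  have "history_dist P \<mu> (Suc n) = bind_pmf \<mu> (\<lambda>\<theta>. bind_pmf (signal_dist P \<theta>)
      (\<lambda>s. map_pmf (Cons s) (replicate_pmf n (signal_dist P \<theta>))))"
    by (simp add: history_dist_def map_pmf_def)
  also have "\<dots> = bind_pmf (next_signal P \<mu>) (\<lambda>s. bind_pmf (posterior P \<mu> s)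
      (\<lambda>\<theta>. map_pmf (Cons s) (replicate_pmf n (signal_dist P \<theta>))))"
    by (rule bind_posterior[symmetric])
  finally show ?thesis
    by (simp add: history_dist_def map_bind_pmf)
qed

lemma belief_after_Nil [simp]: "belief_after P \<mu> [] = \<mu>"
  and belief_after_Cons [simp]:
    "belief_after P \<mu> (s # h) = belief_after P (posterior P \<mu> s) h"
  and belief_after_snoc [simp]:
    "belief_after P \<mu> (h @ [s]) = posterior P (belief_after P \<mu> h) s"
  by (simp_all add: belief_after_def)

lemma waits_until_Nil [simp]: "waits_until \<sigma> h []"
  by (simp add: waits_until_def)

lemma waits_until_Cons [simp]:
  "waits_until \<sigma> h (s # l) \<longleftrightarrow> \<not> \<sigma> h \<and> waits_until \<sigma> (h @ [s]) l"
  by (auto simp: waits_until_def less_Suc_eq_0_disj)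

lemma expectation_bind_pmf:
  fixes f :: "'x \<Rightarrow> real"
  assumes "\<And>x. \<bar>f x\<bar> \<le> C"
  shows "measure_pmf.expectation (bind_pmf p q) f
    = measure_pmf.expectation p (\<lambda>y. measure_pmf.expectation (q y) f)"
  unfolding measure_pmf_bind
  by (rule integral_bind[where K = "count_space UNIV" and B = C and B' = 1])
    (use assms in \<open>auto simp: measure_pmf_in_subprob_algebra measure_pmf.emeasure_space_1\<close>)

section \<open>Recursions for fees and gains\<close>

text \<open>The summands get a name so that partial sums can be bounded by induction. Index
  \<open>k\<close> concerns fees \<open>k + 1\<close> periods ahead, because waiting at
  \<open>h\<close> makes a fee due only in the next period.\<close>

definition fee_term ::
    "('a, 't::finite, 's) stopping_problem \<Rightarrow> ('s list \<Rightarrow> real) \<Rightarrow> ('s list \<Rightarrow> bool)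
       \<Rightarrow> nat \<Rightarrow> 't pmf \<Rightarrow> 's list \<Rightarrow> ennreal" where
  "fee_term P c \<sigma> k \<mu> h =
     ennreal (discount P ^ Suc k) * (\<integral>\<^sup>+ l. ennreal (c (h @ l)) * of_bool (waits_until \<sigma> h l)
        \<partial>measure_pmf (history_dist P \<mu> (Suc k)))"

definition gain_term ::
    "('a, 't::finite, 's) stopping_problem \<Rightarrow> ('s list \<Rightarrow> bool) \<Rightarrow> nat \<Rightarrow> 't pmf \<Rightarrow> 's list \<Rightarrow> real"
  where
  "gain_term P \<sigma> k \<mu> h = discount P ^ k * measure_pmf.expectation (history_dist P \<mu> k)
        (\<lambda>l. stop_payoff P (belief_after P \<mu> l) * of_bool (waits_until \<sigma> h l \<and> \<sigma> (h @ l)))"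

lemma rule_fees_eq: "rule_fees P c \<sigma> \<mu> h = (\<Sum>k. fee_term P c \<sigma> k \<mu> h)"
  by (simp add: rule_fees_def fee_term_def)

lemma rule_gain_eq: "rule_gain P \<sigma> \<mu> h = (\<Sum>k. gain_term P \<sigma> k \<mu> h)"
  by (simp add: rule_gain_def gain_term_def)

text \<open>The uniform bound on the stopping payoff makes expectations finite and lets sums and
  integrals be exchanged, even when the discount factor is 1.\<close>

locale bounded_stopping_problem =
  fixes P :: "('a, 't::finite, 's) stopping_problem" and B :: real
  assumes payoff_bound: "\<And>\<mu>. \<bar>stop_payoff P \<mu>\<bar> \<le> B"
    and discount_pos: "0 < discount P"
    and discount_le_1: "discount P \<le> 1"
begin

lemma bound_nonneg: "0 \<le> B"
  using payoff_bound[of undefined] by linarith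

lemma discount_nonneg [simp]: "0 \<le> discount P"
  using discount_pos by simp

lemma fee_term_stop:
  assumes "\<sigma> h"
  shows "fee_term P c \<sigma> k \<mu> h = 0"
  using assms by (simp add: fee_term_def history_dist_Suc)

lemma fee_term_0:
  assumes "\<not> \<sigma> h"
  shows "fee_term P c \<sigma> 0 \<mu> h
    = ennreal (discount P) * (\<integral>\<^sup>+ s. ennreal (c (h @ [s])) \<partial>measure_pmf (next_signal P \<mu>))"
  using assms by (simp add: fee_term_def history_dist_Suc)

lemma fee_term_Suc:
  assumes "\<not> \<sigma> h"
  shows "fee_term P c \<sigma> (Suc k) \<mu> h = ennreal (discount P) *
    (\<integral>\<^sup>+ s. fee_term P c \<sigma> k (posterior P \<mu> s) (h @ [s]) \<partial>measure_pmf (next_signal P \<mu>))"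
  using assms
  by (simp add: fee_term_def history_dist_Suc[of P \<mu> "Suc k"] nn_integral_cmult ennreal_mult'
      mult.assoc)

lemma sum_fee_term_Suc:
  assumes "\<not> \<sigma> h"
  shows "(\<Sum>k<Suc K. fee_term P c \<sigma> k \<mu> h) = ennreal (discount P) *
    ((\<integral>\<^sup>+ s. ennreal (c (h @ [s])) \<partial>measure_pmf (next_signal P \<mu>)) +
     (\<integral>\<^sup>+ s. (\<Sum>k<K. fee_term P c \<sigma> k (posterior P \<mu> s) (h @ [s]))
        \<partial>measure_pmf (next_signal P \<mu>)))"
  unfolding sum.lessThan_Suc_shift using assms
  by (simp add: fee_term_0 fee_term_Suc nn_integral_sum distrib_left sum_distrib_left)

text \<open>Since fee terms are nonnegative, the infinite sum commutes with the expectation even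
  when the total is infinite.\<close>

lemma rule_fees_wait:
  assumes "\<not> \<sigma> h"
  shows "rule_fees P c \<sigma> \<mu> h = ennreal (discount P) *
    ((\<integral>\<^sup>+ s. ennreal (c (h @ [s])) \<partial>measure_pmf (next_signal P \<mu>)) +
     (\<integral>\<^sup>+ s. rule_fees P c \<sigma> (posterior P \<mu> s) (h @ [s]) \<partial>measure_pmf (next_signal P \<mu>)))"
proof -
  have "rule_fees P c \<sigma> \<mu> h = fee_term P c \<sigma> 0 \<mu> h + (\<Sum>k. fee_term P c \<sigma> (Suc k) \<mu> h)"
    unfolding rule_fees_eq using suminf_offset[of "\<lambda>k. fee_term P c \<sigma> k \<mu> h" 1] by simp
  then show ?thesis
    using assms
    by (simp add: fee_term_0 fee_term_Suc rule_fees_eq nn_integral_suminf distrib_left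
        ennreal_suminf_cmult)
qed

lemma rule_fees_stop: "\<sigma> h \<Longrightarrow> rule_fees P c \<sigma> \<mu> h = 0"
  by (simp add: rule_fees_eq fee_term_stop)

lemma rule_fees_zero [simp]: "rule_fees P (\<lambda>_. 0) \<sigma> \<mu> h = 0"
  by (simp add: rule_fees_def)

section \<open>Expected gains of a stopping rule and their uniform bound\<close>

lemma gain_term_0: "gain_term P \<sigma> 0 \<mu> h = stop_payoff P \<mu> * of_bool (\<sigma> h)"
  by (simp add: gain_term_def)

lemma gain_term_Suc:
  "gain_term P \<sigma> (Suc k) \<mu> h = of_bool (\<not> \<sigma> h) * (discount P *
    measure_pmf.expectation (next_signal P \<mu>) (\<lambda>s. gain_term P \<sigma> k (posterior P \<mu> s) (h @ [s])))"
proof -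
  have "\<bar>stop_payoff P (belief_after P \<mu> l) * of_bool b\<bar> \<le> B" for l b
    using payoff_bound[of "belief_after P \<mu> l"] bound_nonneg by (cases b) auto
  then have "measure_pmf.expectation (history_dist P \<mu> (Suc k))
        (\<lambda>l. stop_payoff P (belief_after P \<mu> l) * of_bool (waits_until \<sigma> h l \<and> \<sigma> (h @ l)))
      = measure_pmf.expectation (next_signal P \<mu>) (\<lambda>s.
         measure_pmf.expectation (history_dist P (posterior P \<mu> s) k)
        (\<lambda>l. stop_payoff P (belief_after P \<mu> (s # l)) *
           of_bool (waits_until \<sigma> h (s # l) \<and> \<sigma> (h @ s # l))))"
    unfolding history_dist_Suc by (subst expectation_bind_pmf[where C = B]) auto
  then show ?thesis
    by (cases "\<sigma> h") (simp_all add: gain_term_def)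
qed

lemma integrable_bounded:
  fixes f :: "'x \<Rightarrow> real"
  assumes "\<And>x. \<bar>f x\<bar> \<le> C"
  shows "integrable (measure_pmf p) f"
  using assms by (intro measure_pmf.integrable_const_bound[of _ C] AE_I2) auto

lemma expectation_le_bound:
  fixes f :: "'x \<Rightarrow> real"
  assumes "\<And>x. \<bar>f x\<bar> \<le> C"
  shows "\<bar>measure_pmf.expectation p f\<bar> \<le> C"
proof -
  have "\<bar>measure_pmf.expectation p f\<bar> \<le> measure_pmf.expectation p (\<lambda>x. \<bar>f x\<bar>)"
    by (rule integral_abs_bound)
  also have "\<dots> \<le> measure_pmf.expectation p (\<lambda>_. C)"
    using assms
    by (intro integral_mono integrable_bounded[of _ C] integrable_abs measure_pmf.integrable_const)
  finally show ?thesis by simp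
qed

text \<open>A rule stops at most once along each history, so the absolute gains of all periods
  together stay below \<open>B\<close>. No geometric series is involved, which gives summability for
  discount factor 1 as well.\<close>

lemma sum_abs_gain_term_le: "(\<Sum>k<K. \<bar>gain_term P \<sigma> k \<mu> h\<bar>) \<le> B"
proof (induction K arbitrary: \<mu> h)
  case 0
  show ?case using bound_nonneg by simp
next
  case (Suc K)
  let ?g = "\<lambda>k s. gain_term P \<sigma> k (posterior P \<mu> s) (h @ [s])"
  let ?E = "measure_pmf.expectation (next_signal P \<mu>)"
  have bd: "\<bar>?g k s\<bar> \<le> B" if "k < K" for k s
    using member_le_sum[of k "{..<K}" "\<lambda>k. \<bar>?g k s\<bar>"] Suc[of "posterior P \<mu> s" "h @ [s]"] that
    by simp
  show ?case
  proof (cases "\<sigma> h")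
    case True
    then show ?thesis
      unfolding sum.lessThan_Suc_shift using payoff_bound
      by (simp add: gain_term_0 gain_term_Suc)
  next
    case False
    have "(\<Sum>k<Suc K. \<bar>gain_term P \<sigma> k \<mu> h\<bar>) = (\<Sum>k<K. discount P * \<bar>?E (?g k)\<bar>)"
      unfolding sum.lessThan_Suc_shift using False
      by (simp add: gain_term_0 gain_term_Suc abs_mult)
    also have "\<dots> \<le> (\<Sum>k<K. ?E (\<lambda>s. \<bar>?g k s\<bar>))"
    proof (rule sum_mono)
      fix k
      have "discount P * \<bar>?E (?g k)\<bar> \<le> \<bar>?E (?g k)\<bar>"
        using discount_le_1 by (intro mult_left_le_one_le) auto
      also have "\<dots> \<le> ?E (\<lambda>s. \<bar>?g k s\<bar>)"
        by (rule integral_abs_bound)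
      finally show "discount P * \<bar>?E (?g k)\<bar> \<le> ?E (\<lambda>s. \<bar>?g k s\<bar>)" .
    qed
    also have "\<dots> = ?E (\<lambda>s. \<Sum>k<K. \<bar>?g k s\<bar>)"
      using bd by (intro Bochner_Integration.integral_sum[symmetric] integrable_bounded[of _ B]) auto
    also have "\<dots> \<le> \<bar>?E (\<lambda>s. \<Sum>k<K. \<bar>?g k s\<bar>)\<bar>" by simp
    also have "\<dots> \<le> B"
      using Suc by (intro expectation_le_bound) (simp add: sum_nonneg)
    finally show ?thesis .
  qed
qed

lemma summable_abs_gain_term: "summable (\<lambda>k. \<bar>gain_term P \<sigma> k \<mu> h\<bar>)"
  by (rule bounded_imp_summable[of _ B])
     (auto simp: sum_abs_gain_term_le lessThan_Suc_atMost[symmetric] simp del: sum.lessThan_Suc)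

lemma summable_gain_term: "summable (\<lambda>k. gain_term P \<sigma> k \<mu> h)"
  using summable_abs_gain_term by (rule summable_rabs_cancel)

lemma abs_rule_gain_le: "\<bar>rule_gain P \<sigma> \<mu> h\<bar> \<le> B"
proof -
  have "\<bar>rule_gain P \<sigma> \<mu> h\<bar> \<le> (\<Sum>k. \<bar>gain_term P \<sigma> k \<mu> h\<bar>)"
    unfolding rule_gain_eq by (rule summable_rabs[OF summable_abs_gain_term])
  also have "\<dots> \<le> B"
    by (rule suminf_le_const[OF summable_abs_gain_term sum_abs_gain_term_le])
  finally show ?thesis .
qed

lemma rule_gain_stop:
  assumes "\<sigma> h"
  shows "rule_gain P \<sigma> \<mu> h = stop_payoff P \<mu>"
  using suminf_split_head[OF summable_gain_term, of \<sigma> \<mu> h] assms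
  by (simp add: rule_gain_eq gain_term_0 gain_term_Suc)

lemma rule_gain_wait:
  assumes "\<not> \<sigma> h"
  shows "rule_gain P \<sigma> \<mu> h = discount P *
    measure_pmf.expectation (next_signal P \<mu>) (\<lambda>s. rule_gain P \<sigma> (posterior P \<mu> s) (h @ [s]))"
proof -
  let ?g = "\<lambda>k s. gain_term P \<sigma> k (posterior P \<mu> s) (h @ [s])"
  let ?E = "measure_pmf.expectation (next_signal P \<mu>)"
  have bd: "\<bar>\<Sum>k<K. ?g k s\<bar> \<le> B" for K s
    using sum_abs[of "\<lambda>k. ?g k s" "{..<K}"] sum_abs_gain_term_le[where K = K] by (rule order_trans)
  have bd1: "\<bar>?g k s\<bar> \<le> B" for k s
    using member_le_sum[of k "{..<Suc k}" "\<lambda>k. \<bar>?g k s\<bar>"]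
      sum_abs_gain_term_le[of \<sigma> "posterior P \<mu> s" "h @ [s]" "Suc k"]
    by (simp del: sum.lessThan_Suc)
  \<comment> \<open>The partial sums converge pointwise and are bounded by the constant
    \<open>B\<close>, so dominated convergence exchanges series and expectation.\<close>
  have "(\<lambda>K. ?E (\<lambda>s. \<Sum>k<K. ?g k s)) \<longlonglongrightarrow> ?E (\<lambda>s. rule_gain P \<sigma> (posterior P \<mu> s) (h @ [s]))"
  proof (rule integral_dominated_convergence[where w = "\<lambda>_. B"])
    show "AE s in measure_pmf (next_signal P \<mu>).
      (\<lambda>K. \<Sum>k<K. ?g k s) \<longlonglongrightarrow> rule_gain P \<sigma> (posterior P \<mu> s) (h @ [s])"
      unfolding rule_gain_eq using summable_gain_term by (intro AE_I2 summable_LIMSEQ)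
  qed (use bd in auto)
  then have "(\<lambda>K. \<Sum>k<K. discount P * ?E (?g k)) \<longlonglongrightarrow>
      discount P * ?E (\<lambda>s. rule_gain P \<sigma> (posterior P \<mu> s) (h @ [s]))"
    using bd1
    by (subst (asm) Bochner_Integration.integral_sum)
       (auto intro!: integrable_bounded[of _ B] tendsto_mult_left simp: sum_distrib_left[symmetric])
  then have "(\<lambda>k. gain_term P \<sigma> (Suc k) \<mu> h) sums
      (discount P * ?E (\<lambda>s. rule_gain P \<sigma> (posterior P \<mu> s) (h @ [s])))"
    using assms by (simp add: sums_def gain_term_Suc)
  \<comment> \<open>The rule does not stop at \<open>h\<close>, so the term of index 0 is zero and
    shifting the series changes nothing.\<close>
  then have "(\<lambda>k. gain_term P \<sigma> k \<mu> h) sums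
      (discount P * ?E (\<lambda>s. rule_gain P \<sigma> (posterior P \<mu> s) (h @ [s])))"
    using assms by (subst (asm) sums_Suc_iff) (simp add: gain_term_0)
  then show ?thesis
    unfolding rule_gain_eq by (rule sums_unique[symmetric])
qed

section \<open>Bellman equations\<close>

lemma continuation_finite_fee:
  assumes "(\<integral>\<^sup>+ s. ennreal (c (h @ [s])) \<partial>measure_pmf (next_signal P \<mu>)) = ennreal e" "0 \<le> e"
  shows "continuation P c v \<mu> h = ereal (discount P *
    (measure_pmf.expectation (next_signal P \<mu>) (\<lambda>s. v (posterior P \<mu> s) (h @ [s])) - e))"
  using assms by (simp add: continuation_def)

text \<open>Positivity of the discount factor matters here: in \<open>ereal\<close> a factor 0 would
  turn minus infinity into 0.\<close>

lemma continuation_infinite_fee: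
  assumes "(\<integral>\<^sup>+ s. ennreal (c (h @ [s])) \<partial>measure_pmf (next_signal P \<mu>)) = \<top>"
  shows "continuation P c v \<mu> h = -\<infinity>"
  using assms discount_pos by (simp add: continuation_def)

lemma continuation_zero_fee:
  "continuation P (\<lambda>_. 0) v \<mu> h = ereal (discount P *
    measure_pmf.expectation (next_signal P \<mu>) (\<lambda>s. v (posterior P \<mu> s) (h @ [s])))"
  by (subst continuation_finite_fee[where e = 0]) auto

lemma fee_cases:
  fixes E :: ennreal
  obtains "E = \<top>" | e where "E = ennreal e" "0 \<le> e"
  by (cases E) auto

lemma continuation_neq_infinity [simp]: "continuation P c v \<mu> h \<noteq> \<infinity>"
  by (rule fee_cases[of "\<integral>\<^sup>+ s. ennreal (c (h @ [s])) \<partial>measure_pmf (next_signal P \<mu>)"])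
     (simp_all add: continuation_infinite_fee continuation_finite_fee)

lemma continuation_le_bound:
  assumes "\<And>\<mu> h. \<bar>v \<mu> h\<bar> \<le> B"
  shows "continuation P c v \<mu> h \<le> ereal B"
proof (rule fee_cases[of "\<integral>\<^sup>+ s. ennreal (c (h @ [s])) \<partial>measure_pmf (next_signal P \<mu>)"])
  fix e :: real
  let ?x = "measure_pmf.expectation (next_signal P \<mu>) (\<lambda>s. v (posterior P \<mu> s) (h @ [s]))"
  assume e: "(\<integral>\<^sup>+ s. ennreal (c (h @ [s])) \<partial>measure_pmf (next_signal P \<mu>)) = ennreal e" "0 \<le> e"
  have "?x - e \<le> B"
    using expectation_le_bound[of "\<lambda>s. v (posterior P \<mu> s) (h @ [s])", OF assms] e(2) by (smt (verit))
  then have "discount P * (?x - e) \<le> discount P * B"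
    by (intro mult_left_mono) auto
  also have "\<dots> \<le> B"
    using bound_nonneg discount_le_1 by (simp add: mult_left_le_one_le)
  finally show ?thesis
    by (simp add: continuation_finite_fee[OF e])
qed (simp add: continuation_infinite_fee)

lemma continuation_mono:
  assumes "\<And>\<mu> h. \<bar>v \<mu> h\<bar> \<le> B" "\<And>\<mu> h. \<bar>w \<mu> h\<bar> \<le> B" "\<And>\<mu> h. v \<mu> h \<le> w \<mu> h"
  shows "continuation P c v \<mu> h \<le> continuation P (\<lambda>_. 0) w \<mu> h"
proof (rule fee_cases[of "\<integral>\<^sup>+ s. ennreal (c (h @ [s])) \<partial>measure_pmf (next_signal P \<mu>)"])
  fix e :: real
  assume e: "(\<integral>\<^sup>+ s. ennreal (c (h @ [s])) \<partial>measure_pmf (next_signal P \<mu>)) = ennreal e" "0 \<le> e"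
  have "measure_pmf.expectation (next_signal P \<mu>) (\<lambda>s. v (posterior P \<mu> s) (h @ [s]))
      \<le> measure_pmf.expectation (next_signal P \<mu>) (\<lambda>s. w (posterior P \<mu> s) (h @ [s]))"
    using assms by (intro integral_mono integrable_bounded[of _ B]) auto
  with e(2) show ?thesis
    by (auto simp: continuation_finite_fee[OF e] continuation_zero_fee intro!: mult_left_mono)
qed (simp add: continuation_infinite_fee)

section \<open>Values with finitely many periods left\<close>

lemma ereal_finite_value_Suc:
  "ereal (finite_value P c (Suc k) \<mu> h)
    = max (ereal (stop_payoff P \<mu>)) (continuation P c (finite_value P c k) \<mu> h)"
proof -
  \<comment> \<open>The maximum is at least the real stopping payoff and never plus infinity, so
    \<open>real_of_ereal\<close> does not meet an infinite argument, which it would send to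
    0.\<close>
  have "ereal (real_of_ereal (max (ereal p) x)) = max (ereal p) x" if "x \<noteq> \<infinity>" for p x
    using that by (cases x) (auto simp: max_def)
  from this[OF continuation_neq_infinity] show ?thesis by simp
qed

lemma abs_finite_value_le: "\<bar>finite_value P c k \<mu> h\<bar> \<le> B"
proof (induction k arbitrary: \<mu> h)
  case 0
  then show ?case using payoff_bound[of \<mu>] bound_nonneg by simp
next
  case (Suc k)
  have "ereal (finite_value P c (Suc k) \<mu> h) \<le> ereal B"
    unfolding ereal_finite_value_Suc
    using payoff_bound[of \<mu>] continuation_le_bound[of "finite_value P c k", OF Suc] by simp
  moreover have "ereal (stop_payoff P \<mu>) \<le> ereal (finite_value P c (Suc k) \<mu> h)"
    unfolding ereal_finite_value_Suc by simp
  ultimately show ?case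
    using payoff_bound[of \<mu>] by (auto simp del: finite_value.simps)
qed

lemma finite_value_mono: "finite_value P c k \<mu> h \<le> finite_value P (\<lambda>_. 0) k \<mu> h"
proof (induction k arbitrary: \<mu> h)
  case 0
  show ?case by simp
next
  case (Suc k)
  have "ereal (finite_value P c (Suc k) \<mu> h) \<le> ereal (finite_value P (\<lambda>_. 0) (Suc k) \<mu> h)"
    unfolding ereal_finite_value_Suc
    by (intro max.mono order_refl continuation_mono abs_finite_value_le Suc)
  then show ?case by (simp del: finite_value.simps)
qed

section \<open>Infinite-horizon values as suprema over stopping rules\<close>

lemma ereal_infinite_value:
  "ereal (infinite_value P c \<mu> h)
    = (SUP \<sigma>. ereal (rule_gain P \<sigma> \<mu> h) - enn2ereal (rule_fees P c \<sigma> \<mu> h))" (is "_ = ?S")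
  and abs_infinite_value_le: "\<bar>infinite_value P c \<mu> h\<bar> \<le> B"
  and payoff_le_infinite_value: "stop_payoff P \<mu> \<le> infinite_value P c \<mu> h"
proof -
  have lower: "ereal (stop_payoff P \<mu>) \<le> ?S"
    by (rule SUP_upper2[of "\<lambda>_. True"]) (auto simp: rule_gain_stop rule_fees_stop zero_ennreal.rep_eq)
  have upper: "?S \<le> ereal B"
  proof (rule SUP_least)
    fix \<sigma> :: "'s list \<Rightarrow> bool"
    have "ereal (rule_gain P \<sigma> \<mu> h) - enn2ereal (rule_fees P c \<sigma> \<mu> h)
        \<le> ereal (rule_gain P \<sigma> \<mu> h)"
      by (cases "rule_fees P c \<sigma> \<mu> h") auto
    also have "\<dots> \<le> ereal B"
      using abs_rule_gain_le[of \<sigma> \<mu> h] by simp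
    finally show "ereal (rule_gain P \<sigma> \<mu> h) - enn2ereal (rule_fees P c \<sigma> \<mu> h) \<le> ereal B" .
  qed
  \<comment> \<open>Stopping at once bounds the supremum from below and the gain bound
    \<open>B\<close> from above, so it is a real number and \<open>real_of_ereal\<close> preserves
    it.\<close>
  from lower upper show eq: "ereal (infinite_value P c \<mu> h) = ?S"
    unfolding infinite_value_def by (cases ?S) auto
  show "\<bar>infinite_value P c \<mu> h\<bar> \<le> B" "stop_payoff P \<mu> \<le> infinite_value P c \<mu> h"
    using lower upper payoff_bound[of \<mu>] unfolding eq[symmetric] by auto
qed

lemma infinite_value_upper:
  "ereal (rule_gain P \<sigma> \<mu> h) - enn2ereal (rule_fees P c \<sigma> \<mu> h) \<le> ereal (infinite_value P c \<mu> h)"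
  unfolding ereal_infinite_value by (rule SUP_upper) simp

lemma infinite_value_mono: "infinite_value P c \<mu> h \<le> infinite_value P (\<lambda>_. 0) \<mu> h"
proof -
  have "ereal (infinite_value P c \<mu> h) \<le> ereal (infinite_value P (\<lambda>_. 0) \<mu> h)"
    unfolding ereal_infinite_value
  proof (rule SUP_mono')
    fix \<sigma> :: "'s list \<Rightarrow> bool"
    show "ereal (rule_gain P \<sigma> \<mu> h) - enn2ereal (rule_fees P c \<sigma> \<mu> h)
        \<le> ereal (rule_gain P \<sigma> \<mu> h) - enn2ereal (rule_fees P (\<lambda>_. 0) \<sigma> \<mu> h)"
      by (cases "rule_fees P c \<sigma> \<mu> h") (auto simp: zero_ennreal.rep_eq)
  qed
  then show ?thesis by simp
qed

text \<open>After one period of waiting, the rest of the rule is a rule started at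
  \<open>h @ [s]\<close>, hence worth at most the infinite-horizon value there. Averaging over
  \<open>s\<close> gives the claim.\<close>

lemma waiting_rule_le_continuation:
  assumes "\<not> \<sigma> h"
  shows "ereal (rule_gain P \<sigma> \<mu> h) - enn2ereal (rule_fees P c \<sigma> \<mu> h)
    \<le> continuation P c (infinite_value P c) \<mu> h"
proof -
  let ?Q = "measure_pmf (next_signal P \<mu>)"
  let ?G = "\<lambda>s. rule_gain P \<sigma> (posterior P \<mu> s) (h @ [s])"
  let ?F = "\<lambda>s. rule_fees P c \<sigma> (posterior P \<mu> s) (h @ [s])"
  let ?V = "\<lambda>s. infinite_value P c (posterior P \<mu> s) (h @ [s])"
  let ?e = "\<integral>\<^sup>+ s. ennreal (c (h @ [s])) \<partial>?Q"
  have fees: "rule_fees P c \<sigma> \<mu> h = ennreal (discount P) * (?e + (\<integral>\<^sup>+ s. ?F s \<partial>?Q))"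
    by (rule rule_fees_wait) fact
  show ?thesis
  proof (cases "?e + (\<integral>\<^sup>+ s. ?F s \<partial>?Q) = \<top>")
    case True
    then have "rule_fees P c \<sigma> \<mu> h = \<top>"
      unfolding fees True using discount_pos by (simp add: ennreal_mult_top)
    then show ?thesis by simp
  next
    case False
    obtain e where e: "?e = ennreal e" "0 \<le> e"
      by (rule fee_cases[of ?e]) (use False in auto)
    obtain f where f: "(\<integral>\<^sup>+ s. ?F s \<partial>?Q) = ennreal f" "0 \<le> f"
      by (rule fee_cases[of "\<integral>\<^sup>+ s. ?F s \<partial>?Q"]) (use False in auto)
    \<comment> \<open>Finite expected later fees are almost surely finite, so they may be replaced
      by their real versions and the comparison made between Bochner integrals.\<close>
    have fin: "AE s in ?Q. ?F s \<noteq> \<infinity>"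
      by (rule nn_integral_PInf_AE) (auto simp: f)
    have "(\<integral>\<^sup>+ s. ennreal (enn2real (?F s)) \<partial>?Q) = ennreal f"
      unfolding f(1)[symmetric] using fin by (intro nn_integral_cong_AE) (auto elim!: eventually_mono simp: less_top)
    then have F: "integrable ?Q (\<lambda>s. enn2real (?F s))" "(\<integral>s. enn2real (?F s) \<partial>?Q) = f"
      using f(2) by (auto simp: integrable_iff_bounded integral_eq_nn_integral)
    have "(\<integral>s. ?G s - enn2real (?F s) \<partial>?Q) \<le> (\<integral>s. ?V s \<partial>?Q)"
    proof (rule integral_mono_AE)
      show "AE s in ?Q. ?G s - enn2real (?F s) \<le> ?V s"
        using fin
      proof (rule eventually_mono)
        fix s
        assume "?F s \<noteq> \<infinity>"
        then show "?G s - enn2real (?F s) \<le> ?V s"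
          using infinite_value_upper[of \<sigma> "posterior P \<mu> s" "h @ [s]" c]
          by (cases "?F s") auto
      qed
    qed (intro Bochner_Integration.integrable_diff F(1)
        integrable_bounded[OF abs_rule_gain_le] integrable_bounded[OF abs_infinite_value_le])+
    also have "(\<integral>s. ?G s - enn2real (?F s) \<partial>?Q) = (\<integral>s. ?G s \<partial>?Q) - f"
      using F abs_rule_gain_le
      by (subst Bochner_Integration.integral_diff) (auto intro: integrable_bounded[of _ B])
    finally have "discount P * ((\<integral>s. ?G s \<partial>?Q) - f - e) \<le> discount P * ((\<integral>s. ?V s \<partial>?Q) - e)"
      by (intro mult_left_mono) auto
    moreover have "rule_fees P c \<sigma> \<mu> h = ennreal (discount P * (e + f))"
      unfolding fees e f using e f by (simp add: ennreal_mult)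
    then have "enn2ereal (rule_fees P c \<sigma> \<mu> h) = ereal (discount P * (e + f))"
      using e(2) f(2) by simp
    ultimately show ?thesis
      unfolding continuation_finite_fee[OF e] rule_gain_wait[where \<sigma> = \<sigma> and h = h, OF assms]
      by (simp add: algebra_simps)
  qed
qed

text \<open>A rule that stops at \<open>h\<close> earns the stopping payoff, and one that waits
  earns at most the continuation. A value different from the stopping payoff exceeds it, so only the
  second bound can be binding.\<close>

lemma infinite_value_waiting:
  assumes "infinite_value P c \<mu> h \<noteq> stop_payoff P \<mu>"
  shows "ereal (infinite_value P c \<mu> h) \<le> continuation P c (infinite_value P c) \<mu> h"
proof -
  have "ereal (infinite_value P c \<mu> h)
      \<le> max (ereal (stop_payoff P \<mu>)) (continuation P c (infinite_value P c) \<mu> h)"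
    unfolding ereal_infinite_value[of c \<mu> h]
  proof (rule SUP_least)
    fix \<sigma> :: "'s list \<Rightarrow> bool"
    show "ereal (rule_gain P \<sigma> \<mu> h) - enn2ereal (rule_fees P c \<sigma> \<mu> h)
        \<le> max (ereal (stop_payoff P \<mu>)) (continuation P c (infinite_value P c) \<mu> h)"
      by (cases "\<sigma> h")
         (simp_all add: rule_gain_stop rule_fees_stop zero_ennreal.rep_eq waiting_rule_le_continuation le_max_iff_disj)
  qed
  then show ?thesis
    using assms payoff_le_infinite_value[of \<mu> c h] by (auto simp: le_max_iff_disj)
qed

text \<open>Rules are judged only at extensions of \<open>h\<close>; this allows different rules to
  be used after different next signals.\<close>

lemma gain_term_cong:
  assumes "\<And>l. \<sigma> (h @ l) = \<tau> (h @ l)"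
  shows "gain_term P \<sigma> k \<mu> h = gain_term P \<tau> k \<mu> h"
  using assms by (simp add: gain_term_def waits_until_def)

text \<open>Patching together nearly optimal rules for each possible next signal.\<close>

lemma continuation_le_infinite_value:
  "continuation P (\<lambda>_. 0) (infinite_value P (\<lambda>_. 0)) \<mu> h \<le> ereal (infinite_value P (\<lambda>_. 0) \<mu> h)"
proof -
  let ?Q = "measure_pmf (next_signal P \<mu>)"
  let ?V = "\<lambda>s. infinite_value P (\<lambda>_. 0) (posterior P \<mu> s) (h @ [s])"
  have "discount P * (\<integral>s. ?V s \<partial>?Q) \<le> infinite_value P (\<lambda>_. 0) \<mu> h + \<epsilon>" if "0 < \<epsilon>" for \<epsilon>
  proof -
    have "\<exists>\<sigma>. ?V s - \<epsilon> < rule_gain P \<sigma> (posterior P \<mu> s) (h @ [s])" for s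
    proof -
      have "ereal (?V s - \<epsilon>) < ereal (?V s)"
        using that by simp
      then show ?thesis
        unfolding ereal_infinite_value less_SUP_iff by (auto simp: zero_ennreal.rep_eq)
    qed
    then obtain \<sigma> where \<sigma>: "\<And>s. ?V s - \<epsilon> < rule_gain P (\<sigma> s) (posterior P \<mu> s) (h @ [s])"
      by metis
    \<comment> \<open>The entry at position \<open>length h\<close> is the signal received right
      after \<open>h\<close>, and it selects the rule to follow. At \<open>h\<close> itself that
      entry does not exist yet, so \<tau> waits.\<close>
    define \<tau> where "\<tau> l = (length h < length l \<and> \<sigma> (l ! length h) l)" for l
    have "rule_gain P \<tau> (posterior P \<mu> s) (h @ [s]) = rule_gain P (\<sigma> s) (posterior P \<mu> s) (h @ [s])"
      for s
      unfolding rule_gain_eq by (intro suminf_cong gain_term_cong) (simp add: \<tau>_def nth_append)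
    then have le: "?V s - \<epsilon> \<le> rule_gain P \<tau> (posterior P \<mu> s) (h @ [s])" for s
      using \<sigma>[of s] by simp
    have "(\<integral>s. ?V s \<partial>?Q) - \<epsilon> = (\<integral>s. ?V s - \<epsilon> \<partial>?Q)"
      using abs_infinite_value_le
      by (subst Bochner_Integration.integral_diff) (auto intro: integrable_bounded[of _ B])
    also have "\<dots> \<le> (\<integral>s. rule_gain P \<tau> (posterior P \<mu> s) (h @ [s]) \<partial>?Q)"
      using le abs_rule_gain_le abs_infinite_value_le
      by (intro integral_mono Bochner_Integration.integrable_diff)
        (auto intro: integrable_bounded[of _ B])
    finally have "discount P * ((\<integral>s. ?V s \<partial>?Q) - \<epsilon>) \<le> rule_gain P \<tau> \<mu> h"
      by (subst rule_gain_wait) (auto simp: \<tau>_def intro: mult_left_mono)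
    moreover have "rule_gain P \<tau> \<mu> h \<le> infinite_value P (\<lambda>_. 0) \<mu> h"
      using infinite_value_upper[of \<tau> \<mu> h "\<lambda>_. 0"] by (simp add: zero_ennreal.rep_eq)
    moreover have "discount P * \<epsilon> \<le> \<epsilon>"
      using that discount_le_1 by (simp add: mult_left_le_one_le)
    ultimately show ?thesis
      by (simp add: algebra_simps)
  qed
  then show ?thesis
    by (simp add: continuation_zero_fee field_le_epsilon)
qed

section \<open>Value bounds and Bellman inequalities for both kinds of horizon\<close>

lemma abs_later_value_le: "\<bar>later_value P c \<mu> h\<bar> \<le> B"
  by (simp add: later_value_def abs_finite_value_le abs_infinite_value_le split: enat.split)

lemma later_value_mono: "later_value P c \<mu> h \<le> later_value P (\<lambda>_. 0) \<mu> h"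
  by (simp add: later_value_def finite_value_mono infinite_value_mono split: enat.split)

lemma continuation_finite_value:
  assumes "horizon P = enat N" "length h < N"
  shows "continuation P c (later_value P c) \<mu> h
    = continuation P c (finite_value P c (N - Suc (length h))) \<mu> h"
  using assms by (simp add: continuation_def later_value_def)

text \<open>Before a finite horizon the number of remaining periods is a successor, so the Bellman
  recursion unfolds and its maximum must be the waiting branch. The infinite case is
  \<open>infinite_value_waiting\<close>.\<close>

lemma later_value_waiting:
  assumes "enat (length h) < horizon P" "later_value P c \<mu> h \<noteq> stop_payoff P \<mu>"
  shows "ereal (later_value P c \<mu> h) \<le> continuation P c (later_value P c) \<mu> h"
proof (cases "horizon P")
  case (enat N)
  then have N: "length h < N" "N - length h = Suc (N - Suc (length h))"
    using assms by auto
  then have "ereal (later_value P c \<mu> h)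
      = max (ereal (stop_payoff P \<mu>)) (continuation P c (later_value P c) \<mu> h)"
    using ereal_finite_value_Suc[of c "N - Suc (length h)" \<mu> h]
    by (simp add: continuation_finite_value enat later_value_def del: finite_value.simps)
  then show ?thesis
    using assms(2) by (auto simp: max_def split: if_splits)
next
  case infinity
  then have "later_value P c = infinite_value P c"
    by (simp add: later_value_def fun_eq_iff)
  then show ?thesis
    using assms(2) infinite_value_waiting by simp
qed

text \<open>Opposite in direction to \<open>later_value_waiting\<close> and valid at every belief,
  since waiting for free is always among the options. Subtracting the two inequalities is what
  bounds the fees.\<close>

lemma continuation_le_later_value:
  assumes "enat (length h) < horizon P"
  shows "continuation P (\<lambda>_. 0) (later_value P (\<lambda>_. 0)) \<mu> h \<le> ereal (later_value P (\<lambda>_. 0) \<mu> h)"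
proof (cases "horizon P")
  case (enat N)
  then have N: "length h < N" "N - length h = Suc (N - Suc (length h))"
    using assms by auto
  then show ?thesis
    using ereal_finite_value_Suc[of "\<lambda>_. 0" "N - Suc (length h)" \<mu> h]
    by (simp add: continuation_finite_value enat later_value_def del: finite_value.simps)
next
  case infinity
  then have "later_value P (\<lambda>_. 0) = infinite_value P (\<lambda>_. 0)"
    by (simp add: later_value_def fun_eq_iff)
  then show ?thesis
    using continuation_le_infinite_value by simp
qed

section \<open>Bounding the fees\<close>

text \<open>Let \<open>e\<close> be the expected next fee and \<open>v\<close>, \<open>w\<close> the
  next values under \<open>c\<close> and under zero fees. Subtracting the first two hypotheses
  bounds the discounted \<open>e + E(w - v)\<close> by \<open>r' - r\<close>, and \<open>F\<close>
  is at most \<open>w - v\<close>. Free \<open>r\<close> and \<open>r'\<close> let this serve later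
  periods and period 0 alike.\<close>

lemma one_period_fees_le:
  assumes "ereal r \<le> continuation P c (later_value P c) \<mu> h"
    and "continuation P (\<lambda>_. 0) (later_value P (\<lambda>_. 0)) \<mu> h \<le> ereal r'"
    and "\<And>s. s \<in> set_pmf (next_signal P \<mu>) \<Longrightarrow> F s \<le> ennreal
      (later_value P (\<lambda>_. 0) (posterior P \<mu> s) (h @ [s]) - later_value P c (posterior P \<mu> s) (h @ [s]))"
  shows "ennreal (discount P) *
    ((\<integral>\<^sup>+ s. ennreal (c (h @ [s])) \<partial>measure_pmf (next_signal P \<mu>)) +
     (\<integral>\<^sup>+ s. F s \<partial>measure_pmf (next_signal P \<mu>))) \<le> ennreal (r' - r)"
proof (rule fee_cases[of "\<integral>\<^sup>+ s. ennreal (c (h @ [s])) \<partial>measure_pmf (next_signal P \<mu>)"])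
  \<comment> \<open>An infinite expected fee would make waiting worth minus infinity, contradicting
    the real lower bound \<open>r\<close>.\<close>
  assume "(\<integral>\<^sup>+ s. ennreal (c (h @ [s])) \<partial>measure_pmf (next_signal P \<mu>)) = \<top>"
  then show ?thesis
    using assms(1) by (simp add: continuation_infinite_fee)
next
  fix e :: real
  assume e: "(\<integral>\<^sup>+ s. ennreal (c (h @ [s])) \<partial>measure_pmf (next_signal P \<mu>)) = ennreal e" "0 \<le> e"
  let ?Q = "measure_pmf (next_signal P \<mu>)"
  let ?v = "\<lambda>s. later_value P c (posterior P \<mu> s) (h @ [s])"
  let ?w = "\<lambda>s. later_value P (\<lambda>_. 0) (posterior P \<mu> s) (h @ [s])"
  have int: "integrable ?Q ?v" "integrable ?Q ?w"
    by (auto intro: integrable_bounded[of _ B] abs_later_value_le)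
  have le: "(\<integral>s. ?v s \<partial>?Q) \<le> (\<integral>s. ?w s \<partial>?Q)"
    using int by (intro integral_mono later_value_mono)
  have "(\<integral>\<^sup>+ s. F s \<partial>?Q) \<le> (\<integral>\<^sup>+ s. ennreal (?w s - ?v s) \<partial>?Q)"
    using assms(3) by (intro nn_integral_mono_AE) (auto simp: AE_measure_pmf_iff)
  also have "\<dots> = ennreal (\<integral>s. ?w s - ?v s \<partial>?Q)"
    using int later_value_mono by (intro nn_integral_eq_integral) auto
  also have "\<dots> = ennreal ((\<integral>s. ?w s \<partial>?Q) - (\<integral>s. ?v s \<partial>?Q))"
    using int by simp
  finally have "ennreal (discount P) * (ennreal e + (\<integral>\<^sup>+ s. F s \<partial>?Q))
      \<le> ennreal (discount P) * (ennreal e + ennreal ((\<integral>s. ?w s \<partial>?Q) - (\<integral>s. ?v s \<partial>?Q)))"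
    by (intro mult_left_mono add_left_mono) auto
  also have "\<dots> = ennreal (discount P * (e + ((\<integral>s. ?w s \<partial>?Q) - (\<integral>s. ?v s \<partial>?Q))))"
    using e(2) le by (simp add: ennreal_mult)
  also have "\<dots> \<le> ennreal (r' - r)"
    using assms(1,2)
    by (intro ennreal_leI) (simp add: continuation_finite_fee[OF e] continuation_zero_fee algebra_simps)
  finally show ?thesis
    by (simp add: e)
qed

text \<open>The assumption on \<sigma> confines waiting to histories where
  \<open>later_value_waiting\<close> applies. Each induction step on \<open>K\<close> then peels off
  one period, and a rule that stops pays nothing.\<close>

lemma partial_fees_le:
  assumes "\<And>h. h \<noteq> [] \<Longrightarrow> \<not> \<sigma> h \<Longrightarrow> enat (length h) < horizon P \<and>
      later_value P c (belief_after P \<mu>0 h) h \<noteq> stop_payoff P (belief_after P \<mu>0 h)"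
    and "h \<noteq> []"
  shows "(\<Sum>k<K. fee_term P c \<sigma> k (belief_after P \<mu>0 h) h) \<le> ennreal
    (later_value P (\<lambda>_. 0) (belief_after P \<mu>0 h) h - later_value P c (belief_after P \<mu>0 h) h)"
  using assms(2)
proof (induction K arbitrary: h)
  case 0
  show ?case by simp
next
  case (Suc K)
  show ?case
  proof (cases "\<sigma> h")
    case True
    then show ?thesis by (simp add: fee_term_stop)
  next
    case False
    note wait = assms(1)[OF Suc.prems False]
    show ?thesis
      unfolding sum_fee_term_Suc[where \<sigma> = \<sigma> and h = h, OF False]
    proof (rule one_period_fees_le)
      show "(\<Sum>k<K. fee_term P c \<sigma> k (posterior P (belief_after P \<mu>0 h) s) (h @ [s])) \<le> ennreal
        (later_value P (\<lambda>_. 0) (posterior P (belief_after P \<mu>0 h) s) (h @ [s])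
          - later_value P c (posterior P (belief_after P \<mu>0 h) s) (h @ [s]))" for s
        using Suc.IH[of "h @ [s]"] by simp
    qed (use wait in \<open>auto intro: later_value_waiting continuation_le_later_value\<close>)
  qed
qed

text \<open>Rewrites the probability-weighted sums over histories as expected fees of a stopping
  rule, so that bounds on all partial sums pass to the infinite sum.\<close>

lemma fees_where_le:
  assumes "\<And>h. W h \<Longrightarrow> enat (length h) \<le> horizon P \<Longrightarrow> waits_until \<sigma> [] h"
    and "\<And>K. ennreal (c []) + (\<Sum>k<K. fee_term P c \<sigma> k \<mu>0 []) \<le> ennreal x" and "0 \<le> x"
  shows "fees_where P \<mu>0 c W \<le> ereal x"
proof -
  let ?f = "\<lambda>n. if enat n \<le> horizon P
       then \<integral>\<^sup>+ h. ennreal (discount P ^ n * c h * pmf (history_dist P \<mu>0 n) h) * of_bool (W h)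
              \<partial>count_space {h. length h = n}
       else 0"
  have f: "?f n \<le> ennreal (discount P ^ n) * (\<integral>\<^sup>+ h. ennreal (c h) * of_bool (waits_until \<sigma> [] h)
        \<partial>measure_pmf (history_dist P \<mu>0 n))" for n
  proof (cases "enat n \<le> horizon P")
    case True
    have "?f n = (\<integral>\<^sup>+ h. ennreal (discount P ^ n * c h * pmf (history_dist P \<mu>0 n) h) * of_bool (W h)
        * indicator {h. length h = n} h \<partial>count_space UNIV)"
      using True by (simp add: nn_integral_count_space_indicator)
    also have "\<dots> \<le> (\<integral>\<^sup>+ h. ennreal (pmf (history_dist P \<mu>0 n) h) * (ennreal (discount P ^ n) *
        (ennreal (c h) * of_bool (waits_until \<sigma> [] h))) \<partial>count_space UNIV)"
    proof (rule nn_integral_mono)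
      fix h
      show "ennreal (discount P ^ n * c h * pmf (history_dist P \<mu>0 n) h) * of_bool (W h)
          * indicator {h. length h = n} h
        \<le> ennreal (pmf (history_dist P \<mu>0 n) h) * (ennreal (discount P ^ n) *
        (ennreal (c h) * of_bool (waits_until \<sigma> [] h)))"
        using True assms(1)[of h]
        by (cases "W h \<and> length h = n") (auto simp: ennreal_mult' ennreal_mult'' mult_ac)
    qed
    also have "\<dots> = (\<integral>\<^sup>+ h. ennreal (discount P ^ n) * (ennreal (c h) * of_bool (waits_until \<sigma> [] h))
        \<partial>measure_pmf (history_dist P \<mu>0 n))"
      by (rule nn_integral_measure_pmf[symmetric])
    finally show ?thesis
      by (simp add: nn_integral_cmult)
  qed simp
  have "(\<Sum>n<K. ?f n) \<le> ennreal x" for K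
  proof -
    \<comment> \<open>One extra period is added so that period 0, which carries the upfront fee, can
      be split off even for \<open>K = 0\<close>.\<close>
    have "(\<Sum>n<K. ?f n) \<le> (\<Sum>n<Suc K. ?f n)"
      by (intro sum_mono2) auto
    also have "\<dots> = ?f 0 + (\<Sum>k<K. ?f (Suc k))"
      by (rule sum.lessThan_Suc_shift)
    also have "\<dots> \<le> ennreal (c []) + (\<Sum>k<K. fee_term P c \<sigma> k \<mu>0 [])"
    proof (intro add_mono sum_mono)
      show "?f 0 \<le> ennreal (c [])"
        using f[of 0] by simp
      show "?f (Suc k) \<le> fee_term P c \<sigma> k \<mu>0 []" for k
        using f[of "Suc k"] by (simp add: fee_term_def)
    qed
    also have "\<dots> \<le> ennreal x" by fact
    finally show ?thesis .
  qed
  then have "(\<Sum>n. ?f n) \<le> ennreal x"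
    by (intro suminf_le_const) auto
  then have "enn2ereal (\<Sum>n. ?f n) \<le> enn2ereal (ennreal x)"
    by (simp only: less_eq_ennreal.rep_eq)
  then show ?thesis
    unfolding fees_where_def using assms(3) by simp
qed

text \<open>Only period 0 contributes, where the null history has probability one and discount
  weight one.\<close>

lemma fees_where_upfront:
  assumes "W []" "0 \<le> y"
  shows "fees_where P \<mu>0 (upfront_fee y) W = ereal y"
proof -
  let ?f = "\<lambda>n. if enat n \<le> horizon P
       then \<integral>\<^sup>+ h. ennreal (discount P ^ n * upfront_fee y h * pmf (history_dist P \<mu>0 n) h)
          * of_bool (W h) \<partial>count_space {h. length h = n}
       else 0"
  have "?f n = 0" if "n \<noteq> 0" for n
  proof -
    have "(\<integral>\<^sup>+ h. ennreal (discount P ^ n * upfront_fee y h * pmf (history_dist P \<mu>0 n) h)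
          * of_bool (W h) \<partial>count_space {h. length h = n}) = (\<integral>\<^sup>+ h. 0 \<partial>count_space {h :: 's list. length h = n})"
      using that by (intro nn_integral_cong) (auto simp: upfront_fee_def)
    then show ?thesis by simp
  qed
  then have "(\<Sum>n. ?f n) = (\<Sum>n\<in>{0}. ?f n)"
    by (intro suminf_finite) auto
  also have "\<dots> = ennreal y"
    using assms(1) by (simp add: nn_integral_count_space_finite upfront_fee_def zero_enat_def[symmetric])
  finally show ?thesis
    unfolding fees_where_def using assms(2) by simp
qed

section \<open>Accepting and declining\<close>

lemma accept_value_neq_infinity [simp]: "accept_value P c \<mu> \<noteq> \<infinity>"
  using continuation_neq_infinity[of c "later_value P c" \<mu> "[]"]
  by (cases "continuation P c (later_value P c) \<mu> []") (auto simp: accept_value_def)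

lemma ereal_value_fun_Nil:
  "ereal (value_fun P c \<mu> []) = max (ereal (stop_payoff P \<mu>)) (accept_value P c \<mu>)"
  using accept_value_neq_infinity[of c \<mu>]
  by (cases "accept_value P c \<mu>") (auto simp: value_fun_def max_def)

text \<open>Once \<open>h\<close> is reached, the fee at \<open>h\<close> is sunk and only fees at
  proper extensions matter. Hence an upfront fee leaves all later values unchanged.\<close>

lemma finite_value_cong:
  assumes "\<And>l. l \<noteq> [] \<Longrightarrow> c (h @ l) = d (h @ l)"
  shows "finite_value P c k \<mu> h = finite_value P d k \<mu> h"
  using assms
proof (induction k arbitrary: \<mu> h)
  case (Suc k)
  have "finite_value P c k \<eta> (h @ [s]) = finite_value P d k \<eta> (h @ [s])" for \<eta> s
    using Suc.prems by (intro Suc.IH) simp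
  then have "continuation P c (finite_value P c k) \<mu> h = continuation P d (finite_value P d k) \<mu> h"
    using Suc.prems by (simp add: continuation_def)
  then show ?case by simp
qed simp

lemma infinite_value_cong:
  assumes "\<And>l. l \<noteq> [] \<Longrightarrow> c (h @ l) = d (h @ l)"
  shows "infinite_value P c \<mu> h = infinite_value P d \<mu> h"
proof -
  have "fee_term P c \<sigma> k \<mu> h = fee_term P d \<sigma> k \<mu> h" for \<sigma> k
    using assms by (simp add: fee_term_def history_dist_Suc)
  then show ?thesis
    by (simp add: infinite_value_def rule_fees_eq)
qed

lemma later_value_cong:
  assumes "\<And>l. l \<noteq> [] \<Longrightarrow> c (h @ l) = d (h @ l)"
  shows "later_value P c \<mu> h = later_value P d \<mu> h"
  unfolding later_value_def
  using finite_value_cong[of c h d, OF assms] infinite_value_cong[of c h d, OF assms]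
  by (simp split: enat.split)

lemma accept_value_upfront:
  "accept_value P (upfront_fee y) \<mu> = accept_value P (\<lambda>_. 0) \<mu> - ereal y"
proof -
  have "later_value P (upfront_fee y) \<eta> [s] = later_value P (\<lambda>_. 0) \<eta> [s]" for \<eta> s
    by (rule later_value_cong) (simp add: upfront_fee_def)
  then have "continuation P (upfront_fee y) (later_value P (upfront_fee y)) \<mu> []
      = continuation P (\<lambda>_. 0) (later_value P (\<lambda>_. 0)) \<mu> []"
    by (simp add: continuation_def upfront_fee_def)
  then show ?thesis
    by (simp add: accept_value_def upfront_fee_def continuation_zero_fee)
qed

lemma accept_value_zero_fee: "\<bar>accept_value P (\<lambda>_. 0) \<mu>\<bar> \<noteq> \<infinity>"
  by (simp add: accept_value_def continuation_zero_fee)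

lemma upfront_fee_in_fee_schemes: "0 \<le> y \<Longrightarrow> upfront_fee y \<in> fee_schemes P"
  by (auto simp: fee_schemes_def upfront_fee_def)

lemma acceptable_accept_value:
  assumes "c \<in> acceptable_schemes P \<mu>0"
  shows "ereal (stop_payoff P \<mu>0) < accept_value P c \<mu>0" "0 \<le> c []"
proof -
  have "ereal (stop_payoff P \<mu>0) < ereal (value_fun P c \<mu>0 [])"
    using assms by (simp add: acceptable_schemes_def)
  then show "ereal (stop_payoff P \<mu>0) < accept_value P c \<mu>0"
    by (simp add: ereal_value_fun_Nil less_max_iff_disj)
  have "[] \<in> histories P"
    by (simp add: histories_def zero_enat_def[symmetric])
  then show "0 \<le> c []"
    using assms by (auto simp: acceptable_schemes_def fee_schemes_def Pi_iff)
qed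

text \<open>
  Truncating at the horizon is built into the rule \<open>\<sigma>\<close>: it stops there, so later fee terms vanish.
\<close>

lemma accepted_fees_le:
  assumes "ereal r \<le> accept_value P c \<mu>0" "accept_value P (\<lambda>_. 0) \<mu>0 = ereal r'" "0 \<le> c []"
    and \<sigma>: "\<And>h. \<sigma> h \<longleftrightarrow> belief_after P \<mu>0 h \<in> stop_set P c h \<or> \<not> enat (length h) < horizon P"
  shows "ennreal (c []) + (\<Sum>k<K. fee_term P c \<sigma> k \<mu>0 []) \<le> ennreal (r' - r)" "r + c [] \<le> r'"
proof -
  have "(\<Sum>k<K. fee_term P c \<sigma> k \<mu>0 []) \<le> ennreal (r' - (r + c [])) \<and> r + c [] \<le> r'" for K
  proof (cases "horizon P = 0")
    case True
    \<comment> \<open>With horizon 0, accepting is worth \<open>- c []\<close>; thus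
      \<open>r' = 0\<close> and \<open>r + c []\<close> is at most 0, while the rule stops
      immediately.\<close>
    then have "\<sigma> []"
      by (simp add: \<sigma> zero_enat_def[symmetric])
    with True assms(1,2) show ?thesis
      by (simp add: fee_term_stop accept_value_def zero_ereal_def)
  next
    case False
    \<comment> \<open>Adding the upfront fee back gives a lower bound for the waiting branch alone;
      it takes the place of \<open>r\<close> in \<open>one_period_fees_le\<close>.\<close>
    then have lo: "ereal (r + c []) \<le> continuation P c (later_value P c) \<mu>0 []"
      using assms(1) by (cases "continuation P c (later_value P c) \<mu>0 []") (auto simp: accept_value_def)
    have hi: "continuation P (\<lambda>_. 0) (later_value P (\<lambda>_. 0)) \<mu>0 [] = ereal r'"
      using False assms(2) by (simp add: accept_value_def continuation_zero_fee)
    have *: "enat (length h) < horizon P \<and>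
        later_value P c (belief_after P \<mu>0 h) h \<noteq> stop_payoff P (belief_after P \<mu>0 h)"
      if "h \<noteq> []" "\<not> \<sigma> h" for h
      using that by (auto simp: \<sigma> stop_set_def value_fun_def)
    have "(\<Sum>k<K. fee_term P c \<sigma> k (posterior P \<mu>0 s) [s]) \<le> ennreal
        (later_value P (\<lambda>_. 0) (posterior P \<mu>0 s) [s] - later_value P c (posterior P \<mu>0 s) [s])" for K s
      using partial_fees_le[of \<sigma> c \<mu>0 "[s]" K, OF *] by simp
    then have "ennreal (discount P) *
        ((\<integral>\<^sup>+ s. ennreal (c ([] @ [s])) \<partial>measure_pmf (next_signal P \<mu>0)) +
         (\<integral>\<^sup>+ s. (\<Sum>k<K. fee_term P c \<sigma> k (posterior P \<mu>0 s) ([] @ [s])) \<partial>measure_pmf (next_signal P \<mu>0)))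
        \<le> ennreal (r' - (r + c []))" for K
      by (intro one_period_fees_le lo) (simp_all add: hi)
    then have "(\<Sum>k<Suc K. fee_term P c \<sigma> k \<mu>0 []) \<le> ennreal (r' - (r + c []))" for K
      by (cases "\<sigma> []") (simp_all only: sum_fee_term_Suc not_False_eq_True fee_term_stop sum.neutral_const zero_le)
    then have "(\<Sum>k<K. fee_term P c \<sigma> k \<mu>0 []) \<le> ennreal (r' - (r + c []))"
      by (cases K) simp_all
    moreover have "ereal (r + c []) \<le> ereal r'"
      unfolding hi[symmetric] using lo
      by (rule order_trans) (intro continuation_mono abs_later_value_le later_value_mono)
    ultimately show ?thesis by simp
  qed
  note * = this
  from * show le: "r + c [] \<le> r'" by blast
  have "ennreal (c []) + (\<Sum>k<K. fee_term P c \<sigma> k \<mu>0 []) \<le> ennreal (c []) + ennreal (r' - (r + c []))"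
    using * by (intro add_left_mono) blast
  also have "\<dots> = ennreal (r' - r)"
    using assms(3) le by (simp add: ennreal_plus[symmetric] del: ennreal_plus)
  finally show "ennreal (c []) + (\<Sum>k<K. fee_term P c \<sigma> k \<mu>0 []) \<le> ennreal (r' - r)" .
qed

text \<open>Strict acceptance means that accepting is worth some \<open>r\<close> above the stopping
  payoff. The decision maker keeps \<open>r\<close>, so at most \<open>r' - r\<close> can be
  collected.\<close>

lemma expected_fees_le:
  assumes "c \<in> acceptable_schemes P \<mu>0" "accept_value P (\<lambda>_. 0) \<mu>0 = ereal r'"
  shows "expected_fees P \<mu>0 c \<le> ereal (r' - stop_payoff P \<mu>0)" "stop_payoff P \<mu>0 < r'"
proof -
  define \<sigma> where
    "\<sigma> h \<longleftrightarrow> belief_after P \<mu>0 h \<in> stop_set P c h \<or> \<not> enat (length h) < horizon P" for h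
  note c = acceptable_accept_value[OF assms(1)]
  obtain r where r: "accept_value P c \<mu>0 = ereal r" "stop_payoff P \<mu>0 < r"
    using c(1) accept_value_neq_infinity[of c \<mu>0] by (cases "accept_value P c \<mu>0") auto
  note le = accepted_fees_le[of r c \<mu>0 r' \<sigma>, OF _ assms(2) c(2) \<sigma>_def]
  have "r \<le> r'" using le(2) r c(2) by simp
  with r show "stop_payoff P \<mu>0 < r'" by simp
  have "expected_fees P \<mu>0 c \<le> ereal (r' - r)"
    unfolding expected_fees_def
  proof (rule fees_where_le)
    fix h
    assume W: "(\<forall>m<length h. belief_after P \<mu>0 (take m h) \<notin> stop_set P c (take m h)) \<and>
      belief_after P \<mu>0 h \<in> acquisition_set P c h" and N: "enat (length h) \<le> horizon P"
    have "enat m < horizon P" if "m < length h" for m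
      using that N by (meson enat_ord_simps(2) order_less_le_trans)
    \<comment> \<open>Acquisition at \<open>h\<close> itself is discarded:
      \<open>waits_until\<close> looks only at proper prefixes, which can only enlarge the fees
      counted.\<close>
    with W show "waits_until \<sigma> [] h"
      by (auto simp: waits_until_def \<sigma>_def)
  qed (use le(1) r \<open>r \<le> r'\<close> in auto)
  also have "\<dots> \<le> ereal (r' - stop_payoff P \<mu>0)"
    using r by simp
  finally show "expected_fees P \<mu>0 c \<le> ereal (r' - stop_payoff P \<mu>0)" .
qed

text \<open>The fee \<open>y\<close> lowers the value of accepting from \<open>r'\<close> to
  \<open>r' - y\<close>, still above the stopping payoff, and all of it falls due at the null
  history.\<close>

lemma upfront_fee_acceptable:
  assumes "accept_value P (\<lambda>_. 0) \<mu>0 = ereal r'" "0 \<le> y" "y < r' - stop_payoff P \<mu>0"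
  shows "upfront_fee y \<in> acceptable_schemes P \<mu>0" "expected_fees P \<mu>0 (upfront_fee y) = ereal y"
proof -
  have "ereal (value_fun P (upfront_fee y) \<mu>0 []) = ereal (r' - y)"
    using assms by (simp add: ereal_value_fun_Nil accept_value_upfront max_def)
  then have v: "stop_payoff P \<mu>0 < value_fun P (upfront_fee y) \<mu>0 []"
    using assms by simp
  then show "upfront_fee y \<in> acceptable_schemes P \<mu>0"
    using assms upfront_fee_in_fee_schemes by (simp add: acceptable_schemes_def)
  show "expected_fees P \<mu>0 (upfront_fee y) = ereal y"
    unfolding expected_fees_def using v assms(2)
    by (intro fees_where_upfront) (auto simp: acquisition_set_def stop_set_def)
qed

lemma information_value_eq:
  assumes "acceptable_schemes P \<mu>0 \<noteq> {}" "accept_value P (\<lambda>_. 0) \<mu>0 = ereal r'"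
  shows "information_value P \<mu>0 = ereal (r' - stop_payoff P \<mu>0)"
  unfolding information_value_def
proof (rule antisym)
  show "(SUP c\<in>acceptable_schemes P \<mu>0. expected_fees P \<mu>0 c) \<le> ereal (r' - stop_payoff P \<mu>0)"
    using expected_fees_le(1) assms(2) by (intro SUP_least) blast
  have pos: "0 < r' - stop_payoff P \<mu>0"
    using expected_fees_le(2) assms by force
  \<comment> \<open>Charging the full amount upfront would leave no strict gain from accepting, so
    the bound is approached by smaller upfront fees.\<close>
  show "ereal (r' - stop_payoff P \<mu>0) \<le> (SUP c\<in>acceptable_schemes P \<mu>0. expected_fees P \<mu>0 c)"
  proof (rule dense_le)
    fix z
    assume z: "z < ereal (r' - stop_payoff P \<mu>0)"
    \<comment> \<open>The level \<open>z\<close> may be negative or minus infinity, whereas a fee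
      must be nonnegative; \<open>pos\<close> makes \<open>y = 0\<close> admissible in that
      case.\<close>
    define y where "y = max 0 (real_of_ereal z)"
    have y: "0 \<le> y" "y < r' - stop_payoff P \<mu>0" "z \<le> ereal y"
      using z pos by (cases z; auto simp: y_def max_def)+
    note up = upfront_fee_acceptable[OF assms(2) y(1,2)]
    have "z \<le> expected_fees P \<mu>0 (upfront_fee y)"
      using y(3) up(2) by simp
    then show "z \<le> (SUP c\<in>acceptable_schemes P \<mu>0. expected_fees P \<mu>0 c)"
      by (rule SUP_upper2[OF up(1)])
  qed
qed

end

section \<open>Boundedness of the stopping payoff, and the theorem\<close>

lemma stop_payoff_bounded:
  fixes P :: "('a, 't::finite, 's) stopping_problem"
  assumes "actions P \<noteq> {}" "\<And>\<theta>. bounded ((\<lambda>a. action_payoff P a \<theta>) ` actions P)"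
  shows "\<exists>B. \<forall>\<mu>. \<bar>stop_payoff P \<mu>\<bar> \<le> B"
proof -
  have "\<exists>b. \<forall>a\<in>actions P. \<bar>action_payoff P a \<theta>\<bar> \<le> b" for \<theta>
    using assms(2)[of \<theta>] by (auto simp: bounded_iff)
  then obtain b where b: "\<And>\<theta> a. a \<in> actions P \<Longrightarrow> \<bar>action_payoff P a \<theta>\<bar> \<le> b \<theta>"
    by metis
  \<comment> \<open>Probabilities are at most 1, so adding the bounds of the individual states gives
    one bound for all beliefs and actions.\<close>
  have "\<bar>stop_payoff P \<mu>\<bar> \<le> (\<Sum>\<theta>\<in>UNIV. b \<theta>)" for \<mu>
    unfolding stop_payoff_def
  proof (rule cSup_abs_le)
    fix x
    assume "x \<in> (\<lambda>a. \<Sum>\<theta>\<in>UNIV. action_payoff P a \<theta> * pmf \<mu> \<theta>) ` actions P"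
    then obtain a where a: "a \<in> actions P" and x: "x = (\<Sum>\<theta>\<in>UNIV. action_payoff P a \<theta> * pmf \<mu> \<theta>)"
      by blast
    have "\<bar>x\<bar> \<le> (\<Sum>\<theta>\<in>UNIV. \<bar>action_payoff P a \<theta> * pmf \<mu> \<theta>\<bar>)"
      unfolding x by (rule sum_abs)
    also have "\<dots> \<le> (\<Sum>\<theta>\<in>UNIV. \<bar>action_payoff P a \<theta>\<bar>)"
      by (intro sum_mono) (simp add: abs_mult mult_right_le_one_le pmf_le_1)
    also have "\<dots> \<le> (\<Sum>\<theta>\<in>UNIV. b \<theta>)"
      by (intro sum_mono b a)
    finally show "\<bar>x\<bar> \<le> (\<Sum>\<theta>\<in>UNIV. b \<theta>)" .
  qed (use assms(1) in simp)
  then show ?thesis by blast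
qed

theorem theorem1:
  fixes P :: "('a::topological_space, 't::finite, 's) stopping_problem" and \<mu>0 :: "'t pmf"
  assumes "CARD('t) \<ge> 2"
    and "compact (actions P)" and "actions P \<noteq> {}"
    and "\<And>\<theta>. continuous_on (actions P) (\<lambda>a. action_payoff P a \<theta>)"
    and "\<And>\<theta>. bounded ((\<lambda>a. action_payoff P a \<theta>) ` actions P)"
    and "0 < discount P" and "discount P \<le> 1"
    and "acceptable_schemes P \<mu>0 \<noteq> {}"
  shows "information_value P \<mu>0 = ereal (value_fun P (\<lambda>_. 0) \<mu>0 [] - stop_payoff P \<mu>0) \<and>
    (let x = value_fun P (\<lambda>_. 0) \<mu>0 [] - stop_payoff P \<mu>0 in
      upfront_fee x \<in> fee_schemes P \<and>
      accept_value P (upfront_fee x) \<mu>0 = ereal (stop_payoff P \<mu>0) \<and>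
      expected_fees_accepted P \<mu>0 (upfront_fee x) = information_value P \<mu>0 \<and>
      (\<forall>y. 0 \<le> y \<and> y < x \<longrightarrow>
         upfront_fee y \<in> acceptable_schemes P \<mu>0 \<and>
         expected_fees P \<mu>0 (upfront_fee y) = ereal y))"
proof -
  obtain B where "\<And>\<mu>. \<bar>stop_payoff P \<mu>\<bar> \<le> B"
    using stop_payoff_bounded[of P] assms(3,5) by blast
  then interpret bounded_stopping_problem P B
    using assms(6,7) by unfold_locales
  obtain r' where r': "accept_value P (\<lambda>_. 0) \<mu>0 = ereal r'"
    using accept_value_zero_fee[of \<mu>0] by (cases "accept_value P (\<lambda>_. 0) \<mu>0") auto
  \<comment> \<open>Some scheme is strictly accepted, and accepting for free is worth at least as
    much. So the maximum defining the period-0 value is attained by accepting.\<close>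
  have pos: "stop_payoff P \<mu>0 < r'"
    using assms(8) expected_fees_le(2) r' by blast
  have "ereal (value_fun P (\<lambda>_. 0) \<mu>0 []) = ereal r'"
    using pos by (simp add: ereal_value_fun_Nil r' max_def)
  then have v: "value_fun P (\<lambda>_. 0) \<mu>0 [] = r'" by simp
  \<comment> \<open>At the full fee she is indifferent, so her prior lies in the stopping set and
    \<open>expected_fees\<close> would not count the payment. The accounting after acceptance does,
    its condition being vacuous at the null history.\<close>
  have "expected_fees_accepted P \<mu>0 (upfront_fee (r' - stop_payoff P \<mu>0))
      = ereal (r' - stop_payoff P \<mu>0)"
    unfolding expected_fees_accepted_def using pos by (intro fees_where_upfront) auto
  moreover have "accept_value P (upfront_fee (r' - stop_payoff P \<mu>0)) \<mu>0 = ereal (stop_payoff P \<mu>0)"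
    by (simp add: accept_value_upfront r')
  ultimately show ?thesis
    using information_value_eq[OF assms(8) r'] upfront_fee_acceptable[OF r'] pos
    by (simp add: v upfront_fee_in_fee_schemes)
qed

end
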